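(* For any bounded system $\mathcal{S}$ with interaction formula $\Gamma$ (written in DNF as $\Gamma=\bigvee_{k=1}^N\bigwedge_{\ell=1}^{M_k}p_{k\ell}$), the following boolean formulae over the state variables are equivalent: \[\Theta(\mathcal{N}_\mathcal{S})\equiv\widetilde{\big(\mathrm{pos}(\Theta(\Gamma)\wedge\mathrm{Init}(\mathcal{S}))\big)}.\]
   Context: A component is $\mathcal{C}=\langle\mathsf{P},\mathsf{S},s_0,\Delta\rangle$ (finite ports $\mathsf{P}$, finite states $\mathsf{S}$, initial state $s_0$, transitions $\Delta\subseteq\mathsf{S}\times\mathsf{P}\times\mathsf{S}$ written $s\xrightarrow{p}s'$), with no two different transitions carrying the same port. A bounded system $\mathcal{S}=\langle\mathcal{C}^1,\ldots,\mathcal{C}^n,\Gamma\rangle$ has components $\mathcal{C}^k=\langle\mathsf{P}^k,\mathsf{S}^k,s_0^k,\Delta^k\rangle$ (pairwise disjoint port and state sets) and a positive boolean interaction formula $\Gamma$ over ports. Minimal models of boolean formulae are taken w.r.t. pointwise order on valuations ($\bot<\top$). The marked Petri net $\mathcal{N}_\mathcal{S}$: places $\bigcup_k\mathsf{S}^k$; for each minimal model $\beta$ of $\Gamma$ a transition $\mathfrak{t}_\beta$ with edges $(s,\mathfrak{t}_\beta),(\mathfrak{t}_\beta,s')$ for every $k$ and every $s\xrightarrow{p}s'\in\Delta^k$ with $\beta(p)=\top$; initial marking marks exactly the states $s_0^k$. A trap is a set $W$ of places such that every transition with an input place in $W$ has an output place in $W$; it is marked if it contains an initially marked place. $\Theta(\mathcal{N}_\mathcal{S}):=\bigwedge\{\bigvee_{i=1}^k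 s_i\mid\{s_1,\ldots,s_k\}\text{ is a marked trap of }\mathcal{N}_\mathcal{S}\}$. For a port $p$ with transition $s\xrightarrow{p}s'$, ${}^\bullet p:=s$, $p^\bullet:=s'$ (both $\bot$ if $p$ labels no transition). $\Theta(\Gamma):=\bigwedge_{k=1}^N(\bigvee_{\ell=1}^{M_k}{}^\bullet p_{k\ell})\rightarrow(\bigvee_{\ell=1}^{M_k}p_{k\ell}^\bullet)$, $\mathrm{Init}(\mathcal{S}):=\bigvee_{k=1}^n s_0^k$. For a boolean formula $f$, $\mathrm{pos}(f)$ is the positive formula obtained by deleting all negative literals from the disjunctive normal form of $f$. For a positive formula $f$ the dual $\widetilde{f}$ is defined by $\widetilde{f_1\wedge f_2}=\widetilde{f_1}\vee\widetilde{f_2}$, $\widetilde{f_1\vee f_2}=\widetilde{f_1}\wedge\widetilde{f_2}$, $\widetilde{a}=a$ for variables $a$. $f\equiv g$ means $f$ and $g$ have the same models.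
   Formalization: The DNF of Γ is required to have no clause subsumed by (or duplicating) another, and pos(f) is taken from any DNF of f without clauses containing both a variable and its negation; for DNFs violating these conditions the equivalence can fail. *)

theory Defs
  imports Main
begin

section \<open>Boolean formulae\<close>

datatype (vars: 'v) form =
    Bot
  | Top
  | Var 'v
  | Neg "'v form"
  | Conj "'v form" "'v form"
  | Disj "'v form" "'v form"
  | Imp "'v form" "'v form"

primrec sat :: "('v \<Rightarrow> bool) \<Rightarrow> 'v form \<Rightarrow> bool" (infix "\<Turnstile>" 50) where
  "\<beta> \<Turnstile> Bot \<longleftrightarrow> False"
| "\<beta> \<Turnstile> Top \<longleftrightarrow> True"
| "\<beta> \<Turnstile> Var v \<longleftrightarrow> \<beta> v"
| "\<beta> \<Turnstile> Neg f \<longleftrightarrow> \<not> \<beta> \<Turnstile> f"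
| "\<beta> \<Turnstile> Conj f g \<longleftrightarrow> \<beta> \<Turnstile> f \<and> \<beta> \<Turnstile> g"
| "\<beta> \<Turnstile> Disj f g \<longleftrightarrow> \<beta> \<Turnstile> f \<or> \<beta> \<Turnstile> g"
| "\<beta> \<Turnstile> Imp f g \<longleftrightarrow> (\<beta> \<Turnstile> f \<longrightarrow> \<beta> \<Turnstile> g)"

definition equivalent :: "'v form \<Rightarrow> 'v form \<Rightarrow> bool" (infix "\<simeq>" 50) where
  "f \<simeq> g \<longleftrightarrow> (\<forall>\<beta>. \<beta> \<Turnstile> f \<longleftrightarrow> \<beta> \<Turnstile> g)"

primrec positive :: "'v form \<Rightarrow> bool" where
  "positive Bot \<longleftrightarrow> True"
| "positive Top \<longleftrightarrow> True"
| "positive (Var v) \<longleftrightarrow> True"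
| "positive (Neg f) \<longleftrightarrow> False"
| "positive (Conj f g) \<longleftrightarrow> positive f \<and> positive g"
| "positive (Disj f g) \<longleftrightarrow> positive f \<and> positive g"
| "positive (Imp f g) \<longleftrightarrow> False"

text \<open>The order on valuations is the pointwise order of the library on \<open>'v \<Rightarrow> bool\<close>.\<close>

definition minimal_model :: "('v \<Rightarrow> bool) \<Rightarrow> 'v form \<Rightarrow> bool" where
  "minimal_model \<beta> f \<longleftrightarrow> \<beta> \<Turnstile> f \<and> (\<forall>\<beta>'. \<beta>' \<Turnstile> f \<and> \<beta>' \<le> \<beta> \<longrightarrow> \<beta>' = \<beta>)"

text \<open>The dual is only meant for positive formulae; it is left unspecified on negations and
  implications.\<close>

fun dual :: "'v form \<Rightarrow> 'v form" where
  "dual Bot = Top"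
| "dual Top = Bot"
| "dual (Var v) = Var v"
| "dual (Conj f g) = Disj (dual f) (dual g)"
| "dual (Disj f g) = Conj (dual f) (dual g)"

definition big_conj :: "'v form list \<Rightarrow> 'v form" where
  "big_conj fs = foldr Conj fs Top"

definition big_disj :: "'v form list \<Rightarrow> 'v form" where
  "big_disj fs = foldr Disj fs Bot"

text \<open>An arbitrary enumeration of a finite set. Up to equivalence, the order in which a
  conjunction or disjunction over a finite set is written does not matter.\<close>

definition enum_of :: "'a set \<Rightarrow> 'a list" where
  "enum_of A = (SOME xs. set xs = A \<and> distinct xs)"

definition conj_over :: "'a set \<Rightarrow> ('a \<Rightarrow> 'v form) \<Rightarrow> 'v form" where
  "conj_over A f = big_conj (map f (enum_of A))"

definition disj_over :: "'a set \<Rightarrow> ('a \<Rightarrow> 'v form) \<Rightarrow> 'v form" where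
  "disj_over A f = big_disj (map f (enum_of A))"


section \<open>Disjunctive normal forms\<close>

datatype 'v literal = PosL 'v | NegL 'v

primrec literal_form :: "'v literal \<Rightarrow> 'v form" where
  "literal_form (PosL v) = Var v"
| "literal_form (NegL v) = Neg (Var v)"

definition dnf_form :: "'v literal list list \<Rightarrow> 'v form" where
  "dnf_form F = big_disj (map (\<lambda>c. big_conj (map literal_form c)) F)"

text \<open>Contradictory clauses are not allowed in a disjunctive normal form: deleting the
  negative literals of a clause containing both \<open>v\<close> and \<open>\<not> v\<close> would turn an
  unsatisfiable disjunct into a satisfiable one, and the result would depend on the choice
  of the normal form even up to equivalence.\<close>

definition consistent_clause :: "'v literal list \<Rightarrow> bool" where
  "consistent_clause c \<longleftrightarrow> \<not> (\<exists>v. PosL v \<in> set c \<and> NegL v \<in> set c)"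

definition dnf_of :: "'v form \<Rightarrow> 'v literal list list \<Rightarrow> bool" where
  "dnf_of f F \<longleftrightarrow> dnf_form F \<simeq> f \<and> (\<forall>c\<in>set F. consistent_clause c)"

primrec is_pos :: "'v literal \<Rightarrow> bool" where
  "is_pos (PosL v) \<longleftrightarrow> True"
| "is_pos (NegL v) \<longleftrightarrow> False"

definition pos :: "'v literal list list \<Rightarrow> 'v form" where
  "pos F = dnf_form (map (filter is_pos) F)"

text \<open>For a positive formula, a clause is given by the list of its variables. Clauses
  subsumed by another clause are not allowed, so that the clauses stand for the minimal
  models. For instance, \<open>p \<or> (p \<and> q)\<close> has to be written as \<open>p\<close>.\<close>

definition positive_dnf_of :: "'v form \<Rightarrow> 'v list list \<Rightarrow> bool" where
  "positive_dnf_of f D \<longleftrightarrow>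
     dnf_form (map (map PosL) D) \<simeq> f \<and>
     (\<forall>i<length D. \<forall>j<length D. i \<noteq> j \<longrightarrow> \<not> set (D ! i) \<subseteq> set (D ! j))"


section \<open>Components and bounded systems\<close>

record ('p, 's) component =
  ports :: "'p set"
  states :: "'s set"
  init :: 's
  steps :: "('s \<times> 'p \<times> 's) set"

definition is_component :: "('p, 's) component \<Rightarrow> bool" where
  "is_component C \<longleftrightarrow>
     finite (ports C) \<and> finite (states C) \<and> init C \<in> states C \<and>
     steps C \<subseteq> states C \<times> ports C \<times> states C \<and>
     (\<forall>s p s' t t'. (s, p, s') \<in> steps C \<and> (t, p, t') \<in> steps C \<longrightarrow> s = t \<and> s' = t')"

record ('p, 's) system =
  comps :: "('p, 's) component list"
  interaction :: "'p form"

definition bounded_system :: "('p, 's) system \<Rightarrow> bool" where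
  "bounded_system S \<longleftrightarrow>
     (\<forall>C\<in>set (comps S). is_component C) \<and>
     (\<forall>i<length (comps S). \<forall>j<length (comps S). i \<noteq> j \<longrightarrow>
        ports (comps S ! i) \<inter> ports (comps S ! j) = {} \<and>
        states (comps S ! i) \<inter> states (comps S ! j) = {}) \<and>
     positive (interaction S) \<and>
     vars (interaction S) \<subseteq> (\<Union>C\<in>set (comps S). ports C)"

definition all_trans :: "('p, 's) system \<Rightarrow> ('s \<times> 'p \<times> 's) set" where
  "all_trans S = (\<Union>C\<in>set (comps S). steps C)"


section \<open>Marked Petri nets and traps\<close>

record ('s, 't) petri_net =
  places :: "'s set"
  transitions :: "'t set"
  edges :: "(('s + 't) \<times> ('s + 't)) set"
  marking :: "'s \<Rightarrow> nat"

definition is_trap :: "('s, 't) petri_net \<Rightarrow> 's set \<Rightarrow> bool" where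
  "is_trap N W \<longleftrightarrow> W \<subseteq> places N \<and>
     (\<forall>t\<in>transitions N.
        (\<exists>s\<in>W. (Inl s, Inr t) \<in> edges N) \<longrightarrow> (\<exists>s\<in>W. (Inr t, Inl s) \<in> edges N))"

definition is_marked_trap :: "('s, 't) petri_net \<Rightarrow> 's set \<Rightarrow> bool" where
  "is_marked_trap N W \<longleftrightarrow> is_trap N W \<and> (\<exists>s\<in>W. marking N s > 0)"

definition theta_net :: "('s, 't) petri_net \<Rightarrow> 's form" where
  "theta_net N = conj_over {W. is_marked_trap N W} (\<lambda>W. disj_over W Var)"

text \<open>The transition \<open>t\<^sub>\<beta>\<close> is represented by the minimal model \<open>\<beta>\<close> itself.\<close>

definition net_of :: "('p, 's) system \<Rightarrow> ('s, 'p \<Rightarrow> bool) petri_net" where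
  "net_of S =
     \<lparr>places = (\<Union>C\<in>set (comps S). states C),
      transitions = {\<beta>. minimal_model \<beta> (interaction S)},
      edges =
        {(Inl s, Inr \<beta>) |s \<beta>. minimal_model \<beta> (interaction S) \<and>
           (\<exists>C\<in>set (comps S). \<exists>p s'. (s, p, s') \<in> steps C \<and> \<beta> p)} \<union>
        {(Inr \<beta>, Inl s') |\<beta> s'. minimal_model \<beta> (interaction S) \<and>
           (\<exists>C\<in>set (comps S). \<exists>s p. (s, p, s') \<in> steps C \<and> \<beta> p)},
      marking = (\<lambda>s. if \<exists>C\<in>set (comps S). s = init C then 1 else 0)\<rparr>"


section \<open>Trap constraints from the interaction formula\<close>

definition pre :: "('p, 's) system \<Rightarrow> 'p \<Rightarrow> 's form" where
  "pre S p =
     (if \<exists>s s'. (s, p, s') \<in> all_trans S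
      then Var (THE s. \<exists>s'. (s, p, s') \<in> all_trans S) else Bot)"

definition post :: "('p, 's) system \<Rightarrow> 'p \<Rightarrow> 's form" where
  "post S p =
     (if \<exists>s s'. (s, p, s') \<in> all_trans S
      then Var (THE s'. \<exists>s. (s, p, s') \<in> all_trans S) else Bot)"

text \<open>The second argument is the interaction formula of the system, written in
  disjunctive normal form.\<close>

definition theta_interaction :: "('p, 's) system \<Rightarrow> 'p list list \<Rightarrow> 's form" where
  "theta_interaction S D =
     big_conj (map (\<lambda>c. Imp (big_disj (map (pre S) c)) (big_disj (map (post S) c))) D)"

definition init_form :: "('p, 's) system \<Rightarrow> 's form" where
  "init_form S = big_disj (map (\<lambda>C. Var (init C)) (comps S))"


section \<open>Existence of disjunctive normal forms\<close>

lemma sat_big_conj: "\<beta> \<Turnstile> big_conj fs \<longleftrightarrow> (\<forall>f\<in>set fs. \<beta> \<Turnstile> f)"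
  by (induction fs) (auto simp: big_conj_def)

lemma sat_big_disj: "\<beta> \<Turnstile> big_disj fs \<longleftrightarrow> (\<exists>f\<in>set fs. \<beta> \<Turnstile> f)"
  by (induction fs) (auto simp: big_disj_def)

lemma sat_dnf_form: "\<beta> \<Turnstile> dnf_form F \<longleftrightarrow> (\<exists>c\<in>set F. \<forall>l\<in>set c. \<beta> \<Turnstile> literal_form l)"
  by (simp add: dnf_form_def sat_big_disj sat_big_conj)

lemma set_enum_of: "finite A \<Longrightarrow> set (enum_of A) = A"
  and distinct_enum_of: "finite A \<Longrightarrow> distinct (enum_of A)"
  unfolding enum_of_def using someI_ex[OF finite_distinct_list] by blast+

lemma finite_vars: "finite (vars f)"
  by (induction f) auto

lemma sat_cong: "(\<And>v. v \<in> vars f \<Longrightarrow> \<beta> v = \<beta>' v) \<Longrightarrow> \<beta> \<Turnstile> f \<longleftrightarrow> \<beta>' \<Turnstile> f"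
  by (induction f) auto

lemma sat_mono: "positive f \<Longrightarrow> \<beta> \<le> \<beta>' \<Longrightarrow> \<beta> \<Turnstile> f \<Longrightarrow> \<beta>' \<Turnstile> f"
  by (induction f) auto

lemma dnf_of_exists: "\<exists>F. dnf_of f F"
proof -
  define cl where "cl A = map PosL (enum_of A) @ map NegL (enum_of (vars f - A))" for A
  define \<M> where "\<M> = {A. A \<subseteq> vars f \<and> (\<lambda>v. v \<in> A) \<Turnstile> f}"
  have fin: "finite \<M>"
    unfolding \<M>_def using finite_vars[of f] by auto
  have cl: "set (cl A) = PosL ` A \<union> NegL ` (vars f - A)" if "A \<in> \<M>" for A
    using that finite_vars[of f] finite_subset[of A "vars f"]
    by (simp add: cl_def \<M>_def set_enum_of)
  have "\<beta> \<Turnstile> dnf_form (map cl (enum_of \<M>)) \<longleftrightarrow> \<beta> \<Turnstile> f" for \<beta>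
  proof -
    have "\<beta> \<Turnstile> dnf_form (map cl (enum_of \<M>)) \<longleftrightarrow>
        (\<exists>A\<in>\<M>. (\<forall>v\<in>A. \<beta> v) \<and> (\<forall>v\<in>vars f - A. \<not> \<beta> v))"
      by (simp add: sat_dnf_form set_enum_of fin cl ball_Un)
    also have "\<dots> \<longleftrightarrow> \<beta> \<Turnstile> f"
    proof
      assume "\<exists>A\<in>\<M>. (\<forall>v\<in>A. \<beta> v) \<and> (\<forall>v\<in>vars f - A. \<not> \<beta> v)"
      then obtain A where A: "A \<in> \<M>" "\<forall>v\<in>A. \<beta> v" "\<forall>v\<in>vars f - A. \<not> \<beta> v"
        by blast
      then have "\<beta> \<Turnstile> f \<longleftrightarrow> (\<lambda>v. v \<in> A) \<Turnstile> f"
        by (intro sat_cong) blast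
      with A(1) show "\<beta> \<Turnstile> f"
        by (simp add: \<M>_def)
    next
      assume f: "\<beta> \<Turnstile> f"
      have "\<beta> \<Turnstile> f \<longleftrightarrow> (\<lambda>v. v \<in> {v \<in> vars f. \<beta> v}) \<Turnstile> f"
        by (intro sat_cong) simp
      with f have "{v \<in> vars f. \<beta> v} \<in> \<M>"
        unfolding \<M>_def by blast
      then show "\<exists>A\<in>\<M>. (\<forall>v\<in>A. \<beta> v) \<and> (\<forall>v\<in>vars f - A. \<not> \<beta> v)"
        by (rule bexI[rotated]) simp
    qed
    finally show ?thesis .
  qed
  moreover have "consistent_clause c" if "c \<in> set (map cl (enum_of \<M>))" for c
    using that by (auto simp: consistent_clause_def set_enum_of fin cl)
  ultimately have "dnf_of f (map cl (enum_of \<M>))"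
    by (simp add: dnf_of_def equivalent_def)
  then show ?thesis ..
qed

lemma positive_dnf_of_exists:
  assumes "positive f"
  shows "\<exists>D. positive_dnf_of f D"
proof -
  let ?P = "\<lambda>A. A \<subseteq> vars f \<and> (\<lambda>v. v \<in> A) \<Turnstile> f"
  define \<M> where "\<M> = {A. ?P A \<and> (\<forall>B. ?P B \<and> B \<subseteq> A \<longrightarrow> B = A)}"
  have fin: "finite \<M>"
    unfolding \<M>_def using finite_vars[of f] by auto
  have finA: "finite A" if "A \<in> \<M>" for A
    using that finite_vars[of f] finite_subset[of A "vars f"] by (simp add: \<M>_def)
  define D where "D = map enum_of (enum_of \<M>)"
  have "\<beta> \<Turnstile> dnf_form (map (map PosL) D) \<longleftrightarrow> \<beta> \<Turnstile> f" for \<beta>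
  proof -
    have "\<beta> \<Turnstile> dnf_form (map (map PosL) D) \<longleftrightarrow> (\<exists>A\<in>\<M>. \<forall>v\<in>A. \<beta> v)"
      by (simp add: sat_dnf_form D_def set_enum_of fin finA)
    also have "\<dots> \<longleftrightarrow> \<beta> \<Turnstile> f"
    proof
      assume "\<exists>A\<in>\<M>. \<forall>v\<in>A. \<beta> v"
      then obtain A where A: "(\<lambda>v. v \<in> A) \<Turnstile> f" "\<forall>v\<in>A. \<beta> v"
        unfolding \<M>_def by blast
      then have "(\<lambda>v. v \<in> A) \<le> \<beta>"
        by (simp add: le_fun_def)
      from sat_mono[OF assms this A(1)] show "\<beta> \<Turnstile> f" .
    next
      assume "\<beta> \<Turnstile> f"
      let ?A = "{v \<in> vars f. \<beta> v}"
      have "\<beta> \<Turnstile> f \<longleftrightarrow> (\<lambda>v. v \<in> ?A) \<Turnstile> f"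
        by (intro sat_cong) simp
      with \<open>\<beta> \<Turnstile> f\<close> have "?P ?A"
        by blast
      moreover have "finite {B. ?P B}"
        using finite_vars[of f] by auto
      ultimately obtain B where "B \<in> {B. ?P B}" "B \<subseteq> ?A"
        "\<forall>B'\<in>{B. ?P B}. B' \<subseteq> B \<longrightarrow> B = B'"
        using finite_has_minimal2[of "{B. ?P B}" ?A] by blast
      then have "B \<in> \<M>" "\<forall>v\<in>B. \<beta> v"
        unfolding \<M>_def by blast+
      then show "\<exists>A\<in>\<M>. \<forall>v\<in>A. \<beta> v"
        by blast
    qed
    finally show ?thesis .
  qed
  moreover have "\<not> set (D ! i) \<subseteq> set (D ! j)"
    if "i < length D" "j < length D" "i \<noteq> j" for i j
  proof -
    let ?A = "enum_of \<M> ! i" and ?B = "enum_of \<M> ! j"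
    have AB: "?A \<in> \<M>" "?B \<in> \<M>"
      using that set_enum_of[OF fin] nth_mem[of _ "enum_of \<M>"] by (auto simp: D_def)
    moreover have "?A \<noteq> ?B"
      using that distinct_enum_of[OF fin] by (simp add: D_def nth_eq_iff_index_eq)
    ultimately have "\<not> ?A \<subseteq> ?B"
      unfolding \<M>_def by blast
    then show ?thesis
      using that AB by (simp add: D_def set_enum_of finA)
  qed
  ultimately have "positive_dnf_of f D"
    by (simp add: positive_dnf_of_def equivalent_def)
  then show ?thesis ..
qed

end

(* Both sides describe hitting sets of marked traps. A valuation satisfies pos f iff it lies
   above a model of f, since a consistent clause is satisfied by the set of its positive
   variables. A valuation therefore satisfies the dual of pos f iff its complement contains no
   model of f, that is, iff it meets every model of f. For f the trap constraint conjoined with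
   the initialization, the models, restricted to the places, are exactly the marked traps,
   because the clauses of the normal form of the interaction formula are its minimal models. *)

theory Submission
  imports Defs
begin

section \<open>Positive parts and duals of formulae\<close>

lemma positive_big_conj: "positive (big_conj fs) \<longleftrightarrow> (\<forall>f\<in>set fs. positive f)"
  by (induction fs) (auto simp: big_conj_def)

lemma positive_big_disj: "positive (big_disj fs) \<longleftrightarrow> (\<forall>f\<in>set fs. positive f)"
  by (induction fs) (auto simp: big_disj_def)

lemma positive_pos: "positive (pos F)"
proof -
  have "positive (literal_form l)" if "is_pos l" for l :: "'v literal"
    using that by (cases l) auto
  then show ?thesis
    by (auto simp: pos_def dnf_form_def positive_big_conj positive_big_disj)
qed

text \<open>De Morgan: pushing a negation down to the variables exchanges the two connectives and
  negates each variable. Positivity excludes \<open>Neg\<close> and \<open>Imp\<close>, where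
  \<open>dual\<close> is unspecified.\<close>

lemma sat_dual: "positive f \<Longrightarrow> \<beta> \<Turnstile> dual f \<longleftrightarrow> \<not> (\<lambda>v. \<not> \<beta> v) \<Turnstile> f"
  by (induction f) auto

lemma sat_literal_form: "\<beta> \<Turnstile> literal_form l \<longleftrightarrow> (case l of PosL v \<Rightarrow> \<beta> v | NegL v \<Rightarrow> \<not> \<beta> v)"
  by (cases l) auto

text \<open>The right-hand side does not mention \<open>F\<close>, so up to equivalence
  \<open>pos F\<close> depends only on \<open>f\<close> and not on the chosen normal form.\<close>

lemma sat_pos_iff:
  assumes "dnf_of f F"
  shows "\<beta> \<Turnstile> pos F \<longleftrightarrow> (\<exists>\<beta>'\<le>\<beta>. \<beta>' \<Turnstile> f)"
proof -
  have f: "\<beta>' \<Turnstile> f \<longleftrightarrow> (\<exists>c\<in>set F. \<forall>l\<in>set c. \<beta>' \<Turnstile> literal_form l)" for \<beta>'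
    using assms by (simp add: dnf_of_def equivalent_def flip: sat_dnf_form)
  have "\<beta> \<Turnstile> pos F \<longleftrightarrow> (\<exists>c\<in>set F. \<forall>v. PosL v \<in> set c \<longrightarrow> \<beta> v)"
  proof -
    have "(\<forall>l\<in>set (filter is_pos c). \<beta> \<Turnstile> literal_form l) \<longleftrightarrow> (\<forall>v. PosL v \<in> set c \<longrightarrow> \<beta> v)" for c
      by (auto simp: sat_literal_form split: literal.splits)
    then show ?thesis
      by (simp add: pos_def sat_dnf_form)
  qed
  also have "\<dots> \<longleftrightarrow> (\<exists>\<beta>'\<le>\<beta>. \<beta>' \<Turnstile> f)"
  proof
    assume "\<exists>c\<in>set F. \<forall>v. PosL v \<in> set c \<longrightarrow> \<beta> v"
    then obtain c where c: "c \<in> set F" "\<forall>v. PosL v \<in> set c \<longrightarrow> \<beta> v"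
      by blast
    \<comment> \<open>The least valuation that makes the positive literals of \<open>c\<close> true.
      Consistency of \<open>c\<close> ensures that it falsifies the variables of the negative
      literals.\<close>
    let ?\<beta> = "\<lambda>v. PosL v \<in> set c"
    have "consistent_clause c"
      using assms c(1) by (simp add: dnf_of_def)
    then have "\<forall>l\<in>set c. ?\<beta> \<Turnstile> literal_form l"
      by (auto simp: consistent_clause_def sat_literal_form split: literal.splits)
    with c(1) have "?\<beta> \<Turnstile> f"
      unfolding f by blast
    moreover have "?\<beta> \<le> \<beta>"
      using c(2) by auto
    ultimately show "\<exists>\<beta>'\<le>\<beta>. \<beta>' \<Turnstile> f"
      by blast
  next
    assume "\<exists>\<beta>'\<le>\<beta>. \<beta>' \<Turnstile> f"
    then obtain \<beta>' c where "\<beta>' \<le> \<beta>" "c \<in> set F" "\<forall>l\<in>set c. \<beta>' \<Turnstile> literal_form l"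
      unfolding f by blast
    then show "\<exists>c\<in>set F. \<forall>v. PosL v \<in> set c \<longrightarrow> \<beta> v"
      by (fastforce simp: sat_literal_form)
  qed
  finally show ?thesis .
qed

lemma sat_dual_pos_iff:
  assumes "dnf_of f F"
  shows "\<beta> \<Turnstile> dual (pos F) \<longleftrightarrow> (\<forall>W. (\<lambda>v. v \<in> W) \<Turnstile> f \<longrightarrow> (\<exists>v\<in>W. \<beta> v))"
proof -
  have "\<beta> \<Turnstile> dual (pos F) \<longleftrightarrow> (\<forall>\<beta>'. \<beta>' \<Turnstile> f \<longrightarrow> \<not> \<beta>' \<le> (\<lambda>v. \<not> \<beta> v))"
    by (auto simp: sat_dual positive_pos sat_pos_iff[OF assms])
  also have "\<dots> \<longleftrightarrow> (\<forall>W. (\<lambda>v. v \<in> W) \<Turnstile> f \<longrightarrow> (\<exists>v\<in>W. \<beta> v))"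
  proof
    assume *: "\<forall>\<beta>'. \<beta>' \<Turnstile> f \<longrightarrow> \<not> \<beta>' \<le> (\<lambda>v. \<not> \<beta> v)"
    show "\<forall>W. (\<lambda>v. v \<in> W) \<Turnstile> f \<longrightarrow> (\<exists>v\<in>W. \<beta> v)"
      using * by (auto simp: le_fun_def)
  next
    assume *: "\<forall>W. (\<lambda>v. v \<in> W) \<Turnstile> f \<longrightarrow> (\<exists>v\<in>W. \<beta> v)"
    show "\<forall>\<beta>'. \<beta>' \<Turnstile> f \<longrightarrow> \<not> \<beta>' \<le> (\<lambda>v. \<not> \<beta> v)"
    proof (intro allI impI)
      \<comment> \<open>Valuations and sets of variables correspond to each other:
        \<open>\<beta>'\<close> is passed to the hypothesis as the set
        \<open>Collect \<beta>'\<close>.\<close>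
      fix \<beta>'
      assume "\<beta>' \<Turnstile> f"
      then show "\<not> \<beta>' \<le> (\<lambda>v. \<not> \<beta> v)"
        using *[rule_format, of "Collect \<beta>'"] by (auto simp: le_fun_def)
    qed
  qed
  finally show ?thesis .
qed

section \<open>Minimal models of a positive formula\<close>

text \<open>Every model lies above the indicator function of some clause, so a minimal model
  coincides with one. Conversely, a model below the indicator of a clause contains another clause,
  and since no clause subsumes another, the two agree.\<close>

lemma minimal_model_iff:
  assumes "positive_dnf_of f D"
  shows "minimal_model \<beta> f \<longleftrightarrow> (\<exists>c\<in>set D. \<beta> = (\<lambda>v. v \<in> set c))"
proof -
  have f: "\<beta> \<Turnstile> f \<longleftrightarrow> (\<exists>c\<in>set D. \<forall>v\<in>set c. \<beta> v)" for \<beta>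
    using assms sat_dnf_form[of \<beta> "map (map PosL) D"]
    by (simp add: positive_dnf_of_def equivalent_def)
  \<comment> \<open>Non-subsumption is required of distinct positions in \<open>D\<close>. An
    inclusion therefore forces equal positions, hence equal lists and not merely equal sets of
    variables.\<close>
  have antichain: "c = c'" if "c \<in> set D" "c' \<in> set D" "set c \<subseteq> set c'" for c c'
    using that assms unfolding positive_dnf_of_def by (metis in_set_conv_nth)
  show ?thesis
  proof
    assume min: "minimal_model \<beta> f"
    then obtain c where c: "c \<in> set D" "\<forall>v\<in>set c. \<beta> v"
      unfolding minimal_model_def f by blast
    have "(\<lambda>v. v \<in> set c) \<Turnstile> f" "(\<lambda>v. v \<in> set c) \<le> \<beta>"
      unfolding f using c by auto
    with min have "\<beta> = (\<lambda>v. v \<in> set c)"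
      unfolding minimal_model_def by blast
    with c(1) show "\<exists>c\<in>set D. \<beta> = (\<lambda>v. v \<in> set c)"
      by blast
  next
    assume "\<exists>c\<in>set D. \<beta> = (\<lambda>v. v \<in> set c)"
    then obtain c where c: "c \<in> set D" "\<beta> = (\<lambda>v. v \<in> set c)"
      by blast
    have "\<beta>' = \<beta>" if \<beta>': "\<beta>' \<Turnstile> f" "\<beta>' \<le> \<beta>" for \<beta>'
    proof -
      obtain c' where c': "c' \<in> set D" "\<forall>v\<in>set c'. \<beta>' v"
        using \<beta>'(1) unfolding f by blast
      have "set c' \<subseteq> set c"
        using c'(2) \<beta>'(2) c(2) by (auto simp: le_fun_def)
      then have "c' = c"
        using antichain c(1) c'(1) by blast
      with c' have "\<beta> \<le> \<beta>'"
        using c(2) by auto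
      with \<beta>'(2) show ?thesis
        by (rule antisym)
    qed
    moreover have "\<beta> \<Turnstile> f"
      unfolding f using c by auto
    ultimately show "minimal_model \<beta> f"
      unfolding minimal_model_def by blast
  qed
qed

section \<open>Ports and places of a bounded system\<close>

text \<open>Disjointness of the port sets makes a port determine its component, and inside a
  component a port labels at most one transition. This justifies the descriptions by
  \<open>THE\<close> in \<open>pre\<close> and \<open>post\<close>.\<close>

lemma all_trans_unique:
  assumes "bounded_system S" "(s, p, s') \<in> all_trans S" "(t, p, t') \<in> all_trans S"
  shows "s = t \<and> s' = t'"
proof -
  obtain i j where i: "i < length (comps S)" "(s, p, s') \<in> steps (comps S ! i)"
    and j: "j < length (comps S)" "(t, p, t') \<in> steps (comps S ! j)"
    using assms(2,3) unfolding all_trans_def by (auto simp: in_set_conv_nth)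
  have comp: "is_component (comps S ! i)" "is_component (comps S ! j)"
    using assms(1) i(1) j(1) by (auto simp: bounded_system_def)
  then have "p \<in> ports (comps S ! i) \<inter> ports (comps S ! j)"
    using i(2) j(2) by (auto simp: is_component_def)
  then have "i = j"
    using assms(1) i(1) j(1) unfolding bounded_system_def by blast
  then show ?thesis
    using comp(1) i(2) j(2) unfolding is_component_def by blast
qed

text \<open>The existential form replaces the definite description and also absorbs the default
  \<open>Bot\<close>: both sides are false if \<open>p\<close> labels no transition.\<close>

lemma sat_pre:
  assumes "bounded_system S"
  shows "\<beta> \<Turnstile> pre S p \<longleftrightarrow> (\<exists>s s'. (s, p, s') \<in> all_trans S \<and> \<beta> s)"
proof (cases "\<exists>s s'. (s, p, s') \<in> all_trans S")
  case True
  then obtain s s' where s: "(s, p, s') \<in> all_trans S"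
    by blast
  then have "(THE s. \<exists>s'. (s, p, s') \<in> all_trans S) = s"
    using all_trans_unique[OF assms] by blast
  with True have "pre S p = Var s"
    by (simp add: pre_def)
  with s show ?thesis
    using all_trans_unique[OF assms s] by (metis sat.simps(3))
qed (simp add: pre_def)

lemma sat_post:
  assumes "bounded_system S"
  shows "\<beta> \<Turnstile> post S p \<longleftrightarrow> (\<exists>s s'. (s, p, s') \<in> all_trans S \<and> \<beta> s')"
proof (cases "\<exists>s s'. (s, p, s') \<in> all_trans S")
  case True
  then obtain s s' where s: "(s, p, s') \<in> all_trans S"
    by blast
  then have "(THE s'. \<exists>s. (s, p, s') \<in> all_trans S) = s'"
    using all_trans_unique[OF assms] by blast
  with True have "post S p = Var s'"
    by (simp add: post_def)
  with s show ?thesis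
    using all_trans_unique[OF assms s] by (metis sat.simps(3))
qed (simp add: post_def)

lemma all_trans_places:
  assumes "bounded_system S" "(s, p, s') \<in> all_trans S"
  shows "s \<in> places (net_of S)" "s' \<in> places (net_of S)"
proof -
  obtain C where C: "C \<in> set (comps S)" "(s, p, s') \<in> steps C"
    using assms(2) unfolding all_trans_def by blast
  then have "steps C \<subseteq> states C \<times> ports C \<times> states C"
    using assms(1) by (simp add: bounded_system_def is_component_def)
  with C show "s \<in> places (net_of S)" "s' \<in> places (net_of S)"
    by (auto simp: net_of_def)
qed

lemma init_places:
  assumes "bounded_system S" "C \<in> set (comps S)"
  shows "init C \<in> places (net_of S)"
  using assms by (auto simp: bounded_system_def is_component_def net_of_def)

lemma finite_places: "bounded_system S \<Longrightarrow> finite (places (net_of S))"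
  by (auto simp: bounded_system_def is_component_def net_of_def)

section \<open>Marked traps as models of the trap constraint\<close>

text \<open>The transitions of the net are the minimal models of the interaction formula, hence by
  \<open>minimal_model_iff\<close> the clauses of \<open>D\<close>. The input and output places of
  such a transition are the sources and targets of the ports in its clause.\<close>

lemma is_trap_net_of_iff:
  assumes "positive_dnf_of (interaction S) D"
  shows "is_trap (net_of S) W \<longleftrightarrow> W \<subseteq> places (net_of S) \<and>
    (\<forall>c\<in>set D. (\<exists>p\<in>set c. \<exists>s s'. (s, p, s') \<in> all_trans S \<and> s \<in> W) \<longrightarrow>
      (\<exists>p\<in>set c. \<exists>s s'. (s, p, s') \<in> all_trans S \<and> s' \<in> W))"
proof -
  have pre_edge: "(\<exists>s\<in>W. (Inl s, Inr \<beta>) \<in> edges (net_of S)) \<longleftrightarrow>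
      (\<exists>p s s'. \<beta> p \<and> (s, p, s') \<in> all_trans S \<and> s \<in> W)"
    if "minimal_model \<beta> (interaction S)" for \<beta>
    using that by (auto simp: net_of_def all_trans_def)
  have post_edge: "(\<exists>s\<in>W. (Inr \<beta>, Inl s) \<in> edges (net_of S)) \<longleftrightarrow>
      (\<exists>p s s'. \<beta> p \<and> (s, p, s') \<in> all_trans S \<and> s' \<in> W)"
    if "minimal_model \<beta> (interaction S)" for \<beta>
    using that by (auto simp: net_of_def all_trans_def)
  have trans: "transitions (net_of S) = {\<beta>. minimal_model \<beta> (interaction S)}"
    by (simp add: net_of_def)
  have "is_trap (net_of S) W \<longleftrightarrow> W \<subseteq> places (net_of S) \<and>
    (\<forall>\<beta>. minimal_model \<beta> (interaction S) \<longrightarrow>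
      (\<exists>p s s'. \<beta> p \<and> (s, p, s') \<in> all_trans S \<and> s \<in> W) \<longrightarrow>
      (\<exists>p s s'. \<beta> p \<and> (s, p, s') \<in> all_trans S \<and> s' \<in> W))"
    unfolding is_trap_def trans using pre_edge post_edge by simp
  moreover have "(\<forall>\<beta>. minimal_model \<beta> (interaction S) \<longrightarrow> P \<beta>) \<longleftrightarrow> (\<forall>c\<in>set D. P (\<lambda>p. p \<in> set c))" for P
    by (auto simp: minimal_model_iff[OF assms])
  ultimately show ?thesis
    by (simp add: Bex_def)
qed

text \<open>A model may contain elements of the state type that are not places. Cutting
  \<open>W\<close> down to the places does not affect satisfaction, because \<open>pre\<close>,
  \<open>post\<close> and \<open>init_form\<close> only mention places.\<close>

lemma is_marked_trap_iff_sat: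
  assumes "bounded_system S" "positive_dnf_of (interaction S) D"
  shows "is_marked_trap (net_of S) (W \<inter> places (net_of S)) \<longleftrightarrow>
    (\<lambda>s. s \<in> W) \<Turnstile> Conj (theta_interaction S D) (init_form S)"
proof -
  have "is_trap (net_of S) (W \<inter> places (net_of S)) \<longleftrightarrow>
      (\<lambda>s. s \<in> W) \<Turnstile> theta_interaction S D"
    unfolding is_trap_net_of_iff[OF assms(2)] theta_interaction_def
    using all_trans_places[OF assms(1)]
    by (simp add: sat_big_conj sat_big_disj sat_pre sat_post assms(1)) blast
  moreover have "(\<exists>s\<in>W \<inter> places (net_of S). marking (net_of S) s > 0) \<longleftrightarrow>
      (\<lambda>s. s \<in> W) \<Turnstile> init_form S"
  proof -
    have "marking (net_of S) s > 0 \<longleftrightarrow> (\<exists>C\<in>set (comps S). s = init C)" for s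
      by (simp add: net_of_def)
    then show ?thesis
      using init_places[OF assms(1)] by (auto simp: init_form_def sat_big_disj)
  qed
  ultimately show ?thesis
    by (simp add: is_marked_trap_def)
qed

text \<open>With finitely many places, each trap and the set of all marked traps are finite, so
  \<open>enum_of\<close> really lists their elements.\<close>

lemma sat_theta_net:
  assumes "finite (places N)"
  shows "\<beta> \<Turnstile> theta_net N \<longleftrightarrow> (\<forall>W. is_marked_trap N W \<longrightarrow> (\<exists>s\<in>W. \<beta> s))"
proof -
  have sub: "W \<subseteq> places N" if "is_marked_trap N W" for W
    using that by (simp add: is_marked_trap_def is_trap_def)
  then have "{W. is_marked_trap N W} \<subseteq> Pow (places N)"
    by blast
  then have "finite {W. is_marked_trap N W}"
    by (rule finite_subset) (simp add: assms)
  moreover have "finite W" if "is_marked_trap N W" for W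
    using sub[OF that] assms by (rule finite_subset)
  ultimately show ?thesis
    by (simp add: theta_net_def conj_over_def disj_over_def sat_big_conj sat_big_disj set_enum_of)
qed

theorem theorem1:
  fixes S :: "('p, 's) system"
    and D :: "'p list list"
    and F :: "'s literal list list"
  assumes "bounded_system S"
    and "positive_dnf_of (interaction S) D"
    and "dnf_of (Conj (theta_interaction S D) (init_form S)) F"
  shows "theta_net (net_of S) \<simeq> dual (pos F)"
  unfolding equivalent_def
proof
  fix \<beta>
  let ?P = "places (net_of S)"
  note model_iff = is_marked_trap_iff_sat[OF assms(1,2), symmetric]
  have "\<beta> \<Turnstile> dual (pos F) \<longleftrightarrow>
      (\<forall>W. is_marked_trap (net_of S) (W \<inter> ?P) \<longrightarrow> (\<exists>s\<in>W. \<beta> s))"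
    unfolding sat_dual_pos_iff[OF assms(3)] model_iff ..
  \<comment> \<open>A place of \<open>W \<inter> ?P\<close> that satisfies \<open>\<beta>\<close>
    also lies in \<open>W\<close>. Conversely, a marked trap equals its own intersection with
    \<open>?P\<close>.\<close>
  also have "\<dots> \<longleftrightarrow> (\<forall>W. is_marked_trap (net_of S) W \<longrightarrow> (\<exists>s\<in>W. \<beta> s))"
  proof -
    have inter: "W \<inter> ?P = W" if "is_marked_trap (net_of S) W" for W
      using that by (auto simp: is_marked_trap_def is_trap_def)
    have "\<exists>s\<in>W. \<beta> s" if "is_marked_trap (net_of S) (W \<inter> ?P)"
      "\<forall>W. is_marked_trap (net_of S) W \<longrightarrow> (\<exists>s\<in>W. \<beta> s)" for W
      using that by blast
    moreover have "\<exists>s\<in>W. \<beta> s" if "is_marked_trap (net_of S) W"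
      "\<forall>W. is_marked_trap (net_of S) (W \<inter> ?P) \<longrightarrow> (\<exists>s\<in>W. \<beta> s)" for W
      using that inter[OF that(1)] by metis
    ultimately show ?thesis
      by blast
  qed
  also have "\<dots> \<longleftrightarrow> \<beta> \<Turnstile> theta_net (net_of S)"
    by (simp add: sat_theta_net finite_places assms(1))
  finally show "\<beta> \<Turnstile> theta_net (net_of S) \<longleftrightarrow> \<beta> \<Turnstile> dual (pos F)"
    by blast
qed

end
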